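(* Let $R$ be a local ring. A right $R$-module $M$ is simple-direct-projective if and only if at least one of the following holds: (i) $\mathrm{soc}(M)\subseteq \mathrm{rad}(M)$; (ii) $M/\mathrm{soc}(M)$ has no maximal submodules.
   Context: Rings are associative with unity and modules are unitary. A (not necessarily commutative) ring is local if it has a unique maximal right ideal. A right module $M$ is simple-direct-projective if, whenever $A$ and $B$ are submodules of $M$ with $B$ simple, $M/A\cong B$ and $B$ a direct summand of $M$, then $A$ is a direct summand of $M$. $\mathrm{soc}(M)$ is the sum of all simple submodules of $M$; $\mathrm{rad}(M)$ is the intersection of all maximal submodules of $M$ (equal to $M$ if there are none). *)

theory Defs
  imports "HOL-Algebra.Module" "HOL-Algebra.AbelCoset"
begin

text \<open>
  Right modules reuse the record \<open>module\<close> of modules over commutative rings, with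
  \<open>r \<odot>\<^bsub>M\<^esub> x\<close> denoting the right action \<open>x r\<close>; hence the order of the factors in
  \<open>ract_assoc\<close>. The library locale \<open>submodule\<close> only asks for an additive subgroup closed
  under \<open>\<odot>\<close>, so it is the right notion of submodule here as well. The fields \<open>mult\<close> and
  \<open>one\<close>, which the record inherits from rings, play no role.
\<close>

locale right_module = R?: ring R + M?: abelian_group M
  for R :: "('a, 'm) ring_scheme" (structure) and M :: "('a, 'b, 'n) module_scheme" (structure) +
  assumes ract_closed:
      "\<lbrakk>r \<in> carrier R; x \<in> carrier M\<rbrakk> \<Longrightarrow> r \<odot>\<^bsub>M\<^esub> x \<in> carrier M"
    and ract_distr_ring:
      "\<lbrakk>r \<in> carrier R; s \<in> carrier R; x \<in> carrier M\<rbrakk> \<Longrightarrow>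
        (r \<oplus>\<^bsub>R\<^esub> s) \<odot>\<^bsub>M\<^esub> x = r \<odot>\<^bsub>M\<^esub> x \<oplus>\<^bsub>M\<^esub> s \<odot>\<^bsub>M\<^esub> x"
    and ract_distr_module:
      "\<lbrakk>r \<in> carrier R; x \<in> carrier M; y \<in> carrier M\<rbrakk> \<Longrightarrow>
        r \<odot>\<^bsub>M\<^esub> (x \<oplus>\<^bsub>M\<^esub> y) = r \<odot>\<^bsub>M\<^esub> x \<oplus>\<^bsub>M\<^esub> r \<odot>\<^bsub>M\<^esub> y"
    and ract_assoc:
      "\<lbrakk>r \<in> carrier R; s \<in> carrier R; x \<in> carrier M\<rbrakk> \<Longrightarrow>
        (r \<otimes>\<^bsub>R\<^esub> s) \<odot>\<^bsub>M\<^esub> x = s \<odot>\<^bsub>M\<^esub> (r \<odot>\<^bsub>M\<^esub> x)"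
    and ract_one:
      "x \<in> carrier M \<Longrightarrow> \<one>\<^bsub>R\<^esub> \<odot>\<^bsub>M\<^esub> x = x"

definition right_ideal :: "'a set \<Rightarrow> ('a, 'm) ring_scheme \<Rightarrow> bool" where
  "right_ideal I R \<longleftrightarrow>
     additive_subgroup I R \<and> (\<forall>x\<in>I. \<forall>r\<in>carrier R. x \<otimes>\<^bsub>R\<^esub> r \<in> I)"

definition maximal_right_ideal :: "'a set \<Rightarrow> ('a, 'm) ring_scheme \<Rightarrow> bool" where
  "maximal_right_ideal I R \<longleftrightarrow>
     right_ideal I R \<and> I \<noteq> carrier R \<and>
     (\<forall>J. right_ideal J R \<and> I \<subseteq> J \<longrightarrow> J = I \<or> J = carrier R)"

text \<open>The zero ring has no maximal right ideal, so it is not local.\<close>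

definition local_ring :: "('a, 'm) ring_scheme \<Rightarrow> bool" where
  "local_ring R \<longleftrightarrow> ring R \<and> (\<exists>!I. maximal_right_ideal I R)"

definition maximal_submodule ::
  "'b set \<Rightarrow> ('a, 'm) ring_scheme \<Rightarrow> ('a, 'b, 'n) module_scheme \<Rightarrow> bool" where
  "maximal_submodule N R M \<longleftrightarrow>
     submodule N R M \<and> N \<noteq> carrier M \<and>
     (\<forall>K. submodule K R M \<and> N \<subseteq> K \<longrightarrow> K = N \<or> K = carrier M)"

definition simple_module ::
  "('a, 'm) ring_scheme \<Rightarrow> ('a, 'b, 'n) module_scheme \<Rightarrow> bool" where
  "simple_module R M \<longleftrightarrow>
     carrier M \<noteq> {\<zero>\<^bsub>M\<^esub>} \<and>
     (\<forall>N. submodule N R M \<longrightarrow> N = {\<zero>\<^bsub>M\<^esub>} \<or> N = carrier M)"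

definition simple_submodule ::
  "'b set \<Rightarrow> ('a, 'm) ring_scheme \<Rightarrow> ('a, 'b, 'n) module_scheme \<Rightarrow> bool" where
  "simple_submodule B R M \<longleftrightarrow> submodule B R M \<and> simple_module R (M\<lparr>carrier := B\<rparr>)"

definition direct_summand ::
  "'b set \<Rightarrow> ('a, 'm) ring_scheme \<Rightarrow> ('a, 'b, 'n) module_scheme \<Rightarrow> bool" where
  "direct_summand N R M \<longleftrightarrow>
     submodule N R M \<and>
     (\<exists>K. submodule K R M \<and> N \<inter> K = {\<zero>\<^bsub>M\<^esub>} \<and> N <+>\<^bsub>M\<^esub> K = carrier M)"

text \<open>The action on cosets is defined in the style of the product of cosets in a quotient ring.\<close>

definition quotient_module ::
  "('a, 'b, 'n) module_scheme \<Rightarrow> 'b set \<Rightarrow> ('a, 'b set) module" where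
  "quotient_module M N =
     \<lparr>carrier = a_rcosets\<^bsub>M\<^esub> N, mult = undefined, one = undefined,
      zero = N, add = set_add M,
      smult = (\<lambda>r X. \<Union>x\<in>X. N +>\<^bsub>M\<^esub> (r \<odot>\<^bsub>M\<^esub> x))\<rparr>"

definition module_iso ::
  "('a, 'm) ring_scheme \<Rightarrow> ('a, 'b, 'n) module_scheme \<Rightarrow> ('a, 'c, 'k) module_scheme \<Rightarrow> ('b \<Rightarrow> 'c) set"
where
  "module_iso R M N =
     {h \<in> iso (add_monoid M) (add_monoid N).
        \<forall>r\<in>carrier R. \<forall>x\<in>carrier M. h (r \<odot>\<^bsub>M\<^esub> x) = r \<odot>\<^bsub>N\<^esub> h x}"

definition simple_direct_projective ::
  "('a, 'm) ring_scheme \<Rightarrow> ('a, 'b, 'n) module_scheme \<Rightarrow> bool" where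
  "simple_direct_projective R M \<longleftrightarrow>
     (\<forall>A B. submodule A R M \<and> simple_submodule B R M \<and>
        module_iso R (quotient_module M A) (M\<lparr>carrier := B\<rparr>) \<noteq> {} \<and>
        direct_summand B R M \<longrightarrow> direct_summand A R M)"

text \<open>
  A sum of submodules consists of the finite sums of elements taken from distinct members of
  the family; the sum of the empty family is zero.
\<close>

definition submodule_sum :: "('a, 'b, 'n) module_scheme \<Rightarrow> 'b set set \<Rightarrow> 'b set" where
  "submodule_sum M \<S> =
     {\<Oplus>\<^bsub>M\<^esub>N\<in>\<F>. f N | f \<F>. finite \<F> \<and> \<F> \<subseteq> \<S> \<and> (\<forall>N\<in>\<F>. f N \<in> N)}"

definition soc :: "('a, 'm) ring_scheme \<Rightarrow> ('a, 'b, 'n) module_scheme \<Rightarrow> 'b set" where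
  "soc R M = submodule_sum M {N. simple_submodule N R M}"

text \<open>Intersecting with the carrier makes the radical all of \<open>M\<close> if there are no maximal submodules.\<close>

definition rad :: "('a, 'm) ring_scheme \<Rightarrow> ('a, 'b, 'n) module_scheme \<Rightarrow> 'b set" where
  "rad R M = carrier M \<inter> \<Inter> {N. maximal_submodule N R M}"

end

theory Submission
  imports Defs
begin

text \<open>
  If \<open>N\<close> is a maximal submodule of \<open>M\<close> and \<open>x\<close> lies outside \<open>N\<close>, then \<open>{r. x r \<in> N}\<close> is a maximal
  right ideal. Over a local ring there is only one, so \<open>M/N\<close> and any simple submodule \<open>S\<close> are both
  cyclic with the same annihilator of a generator and hence isomorphic. Consequently \<open>M\<close> is
  simple-direct-projective iff the existence of a simple summand forces every maximal submodule to
  be a summand. Now a simple \<open>S\<close> is a summand iff some maximal \<open>K\<close> does not contain it, and a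
  maximal \<open>N\<close> is a summand iff it does not contain some simple submodule, i.e. not the socle: in
  both cases the two submodules are complements of each other.
\<close>

section \<open>Arithmetic of the right action, submodules and their sums\<close>

context right_module
begin

lemma ract_zero_left [simp]: "x \<in> carrier M \<Longrightarrow> \<zero>\<^bsub>R\<^esub> \<odot>\<^bsub>M\<^esub> x = \<zero>\<^bsub>M\<^esub>"
  using ract_distr_ring[of "\<zero>\<^bsub>R\<^esub>" "\<zero>\<^bsub>R\<^esub>" x] ract_closed[of "\<zero>\<^bsub>R\<^esub>" x]
  by (metis M.add.r_cancel_one' R.zero_closed R.l_zero)

lemma ract_zero_right [simp]: "r \<in> carrier R \<Longrightarrow> r \<odot>\<^bsub>M\<^esub> \<zero>\<^bsub>M\<^esub> = \<zero>\<^bsub>M\<^esub>"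
  using ract_distr_module[of r "\<zero>\<^bsub>M\<^esub>" "\<zero>\<^bsub>M\<^esub>"] ract_closed[of r "\<zero>\<^bsub>M\<^esub>"]
  by (metis M.add.r_cancel_one' M.zero_closed M.l_zero)

lemma ract_minus_left:
  assumes "r \<in> carrier R" "x \<in> carrier M"
  shows "(\<ominus>\<^bsub>R\<^esub> r) \<odot>\<^bsub>M\<^esub> x = \<ominus>\<^bsub>M\<^esub> (r \<odot>\<^bsub>M\<^esub> x)"
proof -
  have "(\<ominus>\<^bsub>R\<^esub> r) \<odot>\<^bsub>M\<^esub> x \<oplus>\<^bsub>M\<^esub> r \<odot>\<^bsub>M\<^esub> x = \<zero>\<^bsub>M\<^esub>"
    using ract_distr_ring[of "\<ominus>\<^bsub>R\<^esub> r" r x] assms by (simp add: R.l_neg)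
  then show ?thesis
    using assms by (simp add: M.minus_equality ract_closed)
qed

lemma ract_minus_right:
  assumes "r \<in> carrier R" "x \<in> carrier M"
  shows "r \<odot>\<^bsub>M\<^esub> (\<ominus>\<^bsub>M\<^esub> x) = \<ominus>\<^bsub>M\<^esub> (r \<odot>\<^bsub>M\<^esub> x)"
proof -
  have "r \<odot>\<^bsub>M\<^esub> (\<ominus>\<^bsub>M\<^esub> x) \<oplus>\<^bsub>M\<^esub> r \<odot>\<^bsub>M\<^esub> x = \<zero>\<^bsub>M\<^esub>"
    using ract_distr_module[of r "\<ominus>\<^bsub>M\<^esub> x" x] assms by (simp add: M.l_neg)
  then show ?thesis
    using assms by (simp add: M.minus_equality ract_closed)
qed

lemma minus_eq_zero_iff:
  "\<lbrakk>x \<in> carrier M; y \<in> carrier M\<rbrakk> \<Longrightarrow> x \<ominus>\<^bsub>M\<^esub> y = \<zero>\<^bsub>M\<^esub> \<longleftrightarrow> x = y"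
  using M.minus_equality[of x "\<ominus>\<^bsub>M\<^esub> y"] by (auto simp: a_minus_def M.r_neg)

lemma submoduleI:
  assumes "H \<subseteq> carrier M" "\<zero>\<^bsub>M\<^esub> \<in> H"
    and "\<And>x y. x \<in> H \<Longrightarrow> y \<in> H \<Longrightarrow> x \<oplus>\<^bsub>M\<^esub> y \<in> H"
    and smult: "\<And>r x. r \<in> carrier R \<Longrightarrow> x \<in> H \<Longrightarrow> r \<odot>\<^bsub>M\<^esub> x \<in> H"
  shows "submodule H R M"
proof -
  \<comment> \<open>Negation is the action of minus one, so closure under it comes from
    \<open>smult\<close>, and callers never have to check it.\<close>
  have "\<ominus>\<^bsub>M\<^esub> x \<in> H" if "x \<in> H" for x
    using smult[of "\<ominus>\<^bsub>R\<^esub> \<one>\<^bsub>R\<^esub>" x] ract_minus_left[of "\<one>\<^bsub>R\<^esub>" x] ract_one[of x] that assms(1)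
    by auto
  then show ?thesis
    using assms by unfold_locales (auto simp: a_inv_def)
qed

lemma submoduleD:
  assumes "submodule H R M"
  shows submodule_subset: "H \<subseteq> carrier M"
    and submodule_zero: "\<zero>\<^bsub>M\<^esub> \<in> H"
    and submodule_add: "\<And>x y. x \<in> H \<Longrightarrow> y \<in> H \<Longrightarrow> x \<oplus>\<^bsub>M\<^esub> y \<in> H"
    and submodule_smult: "\<And>r x. r \<in> carrier R \<Longrightarrow> x \<in> H \<Longrightarrow> r \<odot>\<^bsub>M\<^esub> x \<in> H"
    and submodule_uminus: "\<And>x. x \<in> H \<Longrightarrow> \<ominus>\<^bsub>M\<^esub> x \<in> H"
proof -
  interpret H: submodule H R M by fact
  show "H \<subseteq> carrier M" using H.subset by simp
  show "\<zero>\<^bsub>M\<^esub> \<in> H" using H.one_closed by simp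
  show "x \<oplus>\<^bsub>M\<^esub> y \<in> H" if "x \<in> H" "y \<in> H" for x y using H.m_closed that by simp
  show "r \<odot>\<^bsub>M\<^esub> x \<in> H" if "r \<in> carrier R" "x \<in> H" for r x using that by (rule H.smult_closed)
  show "\<ominus>\<^bsub>M\<^esub> x \<in> H" if "x \<in> H" for x using H.m_inv_closed that by (simp add: a_inv_def)
qed

lemma zero_submodule: "submodule {\<zero>\<^bsub>M\<^esub>} R M"
  by (rule submoduleI) auto

lemma submodule_inter:
  assumes "submodule H R M" "submodule K R M"
  shows "submodule (H \<inter> K) R M"
  using submoduleD[OF assms(1)] submoduleD[OF assms(2)] by (intro submoduleI) auto

lemma set_add_iff: "z \<in> H <+>\<^bsub>M\<^esub> K \<longleftrightarrow> (\<exists>x\<in>H. \<exists>y\<in>K. z = x \<oplus>\<^bsub>M\<^esub> y)"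
  by (auto simp: set_add_def set_mult_def)

lemma submodule_set_add_comm:
  assumes "submodule H R M" "submodule K R M"
  shows "H <+>\<^bsub>M\<^esub> K = K <+>\<^bsub>M\<^esub> H"
  using submodule_subset[OF assms(1)] submodule_subset[OF assms(2)] M.a_comm
  by (auto simp: set_add_iff subset_iff) metis+

lemma submodule_set_add:
  assumes "submodule H R M" "submodule K R M"
  shows "submodule (H <+>\<^bsub>M\<^esub> K) R M"
proof (rule submoduleI)
  note H = submoduleD[OF assms(1)] and K = submoduleD[OF assms(2)]
  show "H <+>\<^bsub>M\<^esub> K \<subseteq> carrier M" using H(1) K(1) unfolding set_add_iff subset_iff by (auto intro: M.a_closed)
  show "\<zero>\<^bsub>M\<^esub> \<in> H <+>\<^bsub>M\<^esub> K" using H(2) K(2) unfolding set_add_iff by (metis M.l_zero M.zero_closed)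
  show "x \<oplus>\<^bsub>M\<^esub> y \<in> H <+>\<^bsub>M\<^esub> K" if "x \<in> H <+>\<^bsub>M\<^esub> K" "y \<in> H <+>\<^bsub>M\<^esub> K" for x y
  proof -
    obtain a b c d where *: "a \<in> H" "b \<in> K" "c \<in> H" "d \<in> K" "x = a \<oplus>\<^bsub>M\<^esub> b" "y = c \<oplus>\<^bsub>M\<^esub> d"
      using \<open>x \<in> _\<close> \<open>y \<in> _\<close> unfolding set_add_iff by blast
    then have "x \<oplus>\<^bsub>M\<^esub> y = (a \<oplus>\<^bsub>M\<^esub> c) \<oplus>\<^bsub>M\<^esub> (b \<oplus>\<^bsub>M\<^esub> d)"
      using H(1) K(1) by (simp add: subset_iff M.a_ac)
    then show ?thesis using H(3) K(3) * unfolding set_add_iff by blast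
  qed
  show "r \<odot>\<^bsub>M\<^esub> x \<in> H <+>\<^bsub>M\<^esub> K" if "r \<in> carrier R" "x \<in> H <+>\<^bsub>M\<^esub> K" for r x
  proof -
    obtain a b where *: "a \<in> H" "b \<in> K" "x = a \<oplus>\<^bsub>M\<^esub> b"
      using \<open>x \<in> _\<close> unfolding set_add_iff by blast
    then have "r \<odot>\<^bsub>M\<^esub> x = r \<odot>\<^bsub>M\<^esub> a \<oplus>\<^bsub>M\<^esub> r \<odot>\<^bsub>M\<^esub> b"
      using H(1) K(1) that(1) by (simp add: subset_iff ract_distr_module)
    then show ?thesis using H(4) K(4) that(1) * unfolding set_add_iff by blast
  qed
qed

lemma subset_set_add:
  assumes "submodule H R M" "submodule K R M"
  shows "H \<subseteq> H <+>\<^bsub>M\<^esub> K" "K \<subseteq> H <+>\<^bsub>M\<^esub> K"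
proof -
  note H = submoduleD[OF assms(1)] and K = submoduleD[OF assms(2)]
  show "H \<subseteq> H <+>\<^bsub>M\<^esub> K"
    using H(1) K(2) by (auto simp: set_add_iff) (metis M.r_zero subsetD)
  show "K \<subseteq> H <+>\<^bsub>M\<^esub> K"
    using K(1) H(2) by (auto simp: set_add_iff) (metis M.l_zero subsetD)
qed

text \<open>This is the modular law: as \<open>H\<close> lies in \<open>L\<close> and
  \<open>H + K\<close> is everything, \<open>L = H + (L \<inter> K)\<close>, and the second summand
  is absorbed by \<open>H\<close>. Both complement lemmas below rest on it, with the roles of the
  submodules exchanged.\<close>

lemma complement_modular:
  assumes "submodule H R M" "submodule K R M" "submodule L R M"
    and sum: "H <+>\<^bsub>M\<^esub> K = carrier M" and "H \<subseteq> L" and "L \<inter> K \<subseteq> H"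
  shows "L = H"
proof
  note H = submoduleD[OF assms(1)] and K = submoduleD[OF assms(2)] and L = submoduleD[OF assms(3)]
  show "L \<subseteq> H"
  proof
    fix x assume x: "x \<in> L"
    then have "x \<in> H <+>\<^bsub>M\<^esub> K" using L(1) sum by blast
    then obtain h k where hk: "h \<in> H" "k \<in> K" "x = h \<oplus>\<^bsub>M\<^esub> k" unfolding set_add_iff by blast
    then have c: "h \<in> carrier M" "k \<in> carrier M" using H(1) K(1) by auto
    have "k = \<ominus>\<^bsub>M\<^esub> h \<oplus>\<^bsub>M\<^esub> x" using hk(3) c by (simp add: M.r_neg1)
    then have "k \<in> L" using L(3,5) x hk(1) \<open>H \<subseteq> L\<close> by auto
    then have "k \<in> H" using hk \<open>L \<inter> K \<subseteq> H\<close> by auto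
    then show "x \<in> H" using hk H(3) by simp
  qed
qed fact

section \<open>Simple submodules, maximal submodules and complements\<close>

lemma right_module_submodule:
  assumes "submodule B R M"
  shows "right_module R (M\<lparr>carrier := B\<rparr>)"
proof -
  interpret B: submodule B R M by fact
  note B = submoduleD[OF assms]
  have "\<exists>y\<in>B. y \<oplus>\<^bsub>M\<^esub> x = \<zero>\<^bsub>M\<^esub>" if "x \<in> B" for x
    using that B(1) B(5)[OF that] by (intro bexI[of _ "\<ominus>\<^bsub>M\<^esub> x"]) (auto intro: M.l_neg)
  then have "abelian_group (M\<lparr>carrier := B\<rparr>)"
    using B(1-3) by (intro abelian_groupI) (auto simp: subset_iff M.a_ac)
  then show ?thesis
    using B by (intro right_module.intro right_module_axioms.intro R.ring_axioms)
     (auto simp: subset_iff ract_distr_ring ract_distr_module ract_assoc ract_one)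
qed

text \<open>Simplicity is defined through the submodules of \<open>B\<close> taken as a module of
  its own. This lemma allows it to be tested inside \<open>M\<close>, which is where all complements
  live.\<close>

lemma submodule_submodule_iff:
  assumes "submodule B R M"
  shows "submodule L R (M\<lparr>carrier := B\<rparr>) \<longleftrightarrow> submodule L R M \<and> L \<subseteq> B"
proof -
  interpret B: right_module R "M\<lparr>carrier := B\<rparr>" by (rule right_module_submodule) fact
  note B = submoduleD[OF assms]
  show ?thesis
  proof
    assume "submodule L R (M\<lparr>carrier := B\<rparr>)"
    from B.submoduleD[OF this] show "submodule L R M \<and> L \<subseteq> B"
      using B(1) by (auto intro!: submoduleI)
  next
    assume L: "submodule L R M \<and> L \<subseteq> B"
    from submoduleD[OF conjunct1[OF L]] show "submodule L R (M\<lparr>carrier := B\<rparr>)"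
      using L by (intro B.submoduleI) auto
  qed
qed

lemma simple_submodule_iff:
  "simple_submodule B R M \<longleftrightarrow> submodule B R M \<and> B \<noteq> {\<zero>\<^bsub>M\<^esub>} \<and>
     (\<forall>L. submodule L R M \<and> L \<subseteq> B \<longrightarrow> L = {\<zero>\<^bsub>M\<^esub>} \<or> L = B)"
  unfolding simple_submodule_def simple_module_def using submodule_submodule_iff by auto

text \<open>In this form, facts about maximal submodules apply to simple modules too: the zero
  submodule can be pulled back along epimorphisms, and annihilators of elements become a case of the
  transporter construction.\<close>

lemma simple_module_iff_maximal: "simple_module R M \<longleftrightarrow> maximal_submodule {\<zero>\<^bsub>M\<^esub>} R M"
  unfolding simple_module_def maximal_submodule_def
  using zero_submodule submodule_zero by auto

text \<open>A submodule \<open>L\<close> above \<open>K\<close> meets the simple \<open>S\<close> in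
  zero or in all of \<open>S\<close>. In the first case the modular law collapses \<open>L\<close>
  to \<open>K\<close>; in the second, \<open>L\<close> contains both summands.\<close>

lemma maximal_submodule_complement:
  assumes S: "simple_submodule S R M" and K: "submodule K R M"
    and "S \<inter> K = {\<zero>\<^bsub>M\<^esub>}" and sum: "S <+>\<^bsub>M\<^esub> K = carrier M"
  shows "maximal_submodule K R M"
proof -
  have S': "submodule S R M" using S by (simp add: simple_submodule_iff)
  have sum': "K <+>\<^bsub>M\<^esub> S = carrier M"
    using sum submodule_set_add_comm[OF S' K] by simp
  have "K \<noteq> carrier M"
    using S assms(3) submodule_subset[OF S'] by (auto simp: simple_submodule_iff)
  moreover have "L = K \<or> L = carrier M" if L: "submodule L R M" "K \<subseteq> L" for L
  proof -
    consider "L \<inter> S = {\<zero>\<^bsub>M\<^esub>}" | "L \<inter> S = S"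
      using S submodule_inter[OF L(1) S'] by (auto simp: simple_submodule_iff)
    then show ?thesis
    proof cases
      case 1
      then have "L = K"
        using complement_modular[OF K S' L(1) sum' L(2)] submodule_zero[OF K] by simp
      then show ?thesis ..
    next
      case 2
      have "carrier M \<subseteq> L"
        unfolding sum[symmetric] using 2 L(2) by (auto simp: set_add_iff intro!: submodule_add[OF L(1)])
      then show ?thesis using submodule_subset[OF L(1)] by auto
    qed
  qed
  ultimately show ?thesis using K by (auto simp: maximal_submodule_def)
qed

text \<open>Dually, for \<open>L\<close> inside \<open>K\<close> the sum \<open>N + L\<close> is
  \<open>N\<close> or everything. In the first case \<open>L\<close> lies in
  \<open>N \<inter> K\<close>, which is zero; in the second, \<open>L\<close> is already a
  complement of \<open>N\<close>, and the modular law forces \<open>L = K\<close>.\<close>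

lemma simple_submodule_complement:
  assumes N: "maximal_submodule N R M" and K: "submodule K R M"
    and int: "N \<inter> K = {\<zero>\<^bsub>M\<^esub>}" and sum: "N <+>\<^bsub>M\<^esub> K = carrier M"
  shows "simple_submodule K R M"
proof -
  have N': "submodule N R M" "N \<noteq> carrier M" using N by (auto simp: maximal_submodule_def)
  have sum': "K <+>\<^bsub>M\<^esub> N = carrier M"
    using sum submodule_set_add_comm[OF N'(1) K] by simp
  have "K \<noteq> {\<zero>\<^bsub>M\<^esub>}"
  proof
    assume "K = {\<zero>\<^bsub>M\<^esub>}"
    then have "carrier M \<subseteq> N"
      unfolding sum[symmetric] using submodule_add[OF N'(1)] submodule_zero[OF N'(1)]
      by (auto simp: set_add_iff)
    then show False using N' submodule_subset[OF N'(1)] by auto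
  qed
  moreover have "L = {\<zero>\<^bsub>M\<^esub>} \<or> L = K" if L: "submodule L R M" "L \<subseteq> K" for L
  proof -
    have "N <+>\<^bsub>M\<^esub> L = N \<or> N <+>\<^bsub>M\<^esub> L = carrier M"
      using N submodule_set_add[OF N'(1) L(1)] subset_set_add[OF N'(1) L(1)]
      by (auto simp: maximal_submodule_def)
    then show ?thesis
    proof
      assume "N <+>\<^bsub>M\<^esub> L = N"
      then have "L \<subseteq> N \<inter> K" using subset_set_add[OF N'(1) L(1)] L(2) by auto
      then show ?thesis using int submodule_zero[OF L(1)] by auto
    next
      assume "N <+>\<^bsub>M\<^esub> L = carrier M"
      then have "L <+>\<^bsub>M\<^esub> N = carrier M"
        using submodule_set_add_comm[OF N'(1) L(1)] by simp
      then have "K = L"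
        using submodule_zero[OF L(1)]
        by (intro complement_modular[OF L(1) N'(1) K _ L(2)]) (simp_all add: Int_commute[of K N] int)
      then show ?thesis by simp
    qed
  qed
  ultimately show ?thesis using K by (auto simp: simple_submodule_iff)
qed

text \<open>The intersection is a submodule of \<open>S\<close> other than \<open>S\<close>, and the
  sum is a submodule above \<open>N\<close> other than \<open>N\<close>, so simplicity and
  maximality leave one possibility each.\<close>

lemma maximal_simple_complement:
  assumes N: "maximal_submodule N R M" and S: "simple_submodule S R M" and "\<not> S \<subseteq> N"
  shows "N \<inter> S = {\<zero>\<^bsub>M\<^esub>}" and "N <+>\<^bsub>M\<^esub> S = carrier M"
proof -
  have N': "submodule N R M" and S': "submodule S R M"
    using N S by (auto simp: maximal_submodule_def simple_submodule_iff)
  show "N \<inter> S = {\<zero>\<^bsub>M\<^esub>}"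
    using S submodule_inter[OF N' S'] \<open>\<not> S \<subseteq> N\<close> by (auto simp: simple_submodule_iff)
  show "N <+>\<^bsub>M\<^esub> S = carrier M"
    using N submodule_set_add[OF N' S'] subset_set_add[OF N' S'] \<open>\<not> S \<subseteq> N\<close>
    by (auto simp: maximal_submodule_def)
qed

end

section \<open>Surjective homomorphisms and the correspondence of maximal submodules\<close>

locale module_epi = M: right_module R M + N: right_module R N
  for R :: "('a, 'm) ring_scheme" and M :: "('a, 'b, 'n) module_scheme"
    and N :: "('a, 'c, 'k) module_scheme" +
  fixes f :: "'b \<Rightarrow> 'c"
  assumes f_image: "f ` carrier M = carrier N"
    and f_add: "\<lbrakk>x \<in> carrier M; y \<in> carrier M\<rbrakk> \<Longrightarrow> f (x \<oplus>\<^bsub>M\<^esub> y) = f x \<oplus>\<^bsub>N\<^esub> f y"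
    and f_ract: "\<lbrakk>r \<in> carrier R; x \<in> carrier M\<rbrakk> \<Longrightarrow> f (r \<odot>\<^bsub>M\<^esub> x) = r \<odot>\<^bsub>N\<^esub> f x"
begin

lemma f_closed: "x \<in> carrier M \<Longrightarrow> f x \<in> carrier N"
  using f_image by auto

lemma f_zero: "f \<zero>\<^bsub>M\<^esub> = \<zero>\<^bsub>N\<^esub>"
  using f_ract[of "\<zero>\<^bsub>R\<^esub>" "\<zero>\<^bsub>M\<^esub>"] f_closed[of "\<zero>\<^bsub>M\<^esub>"] by simp

lemma f_uminus: "x \<in> carrier M \<Longrightarrow> f (\<ominus>\<^bsub>M\<^esub> x) = \<ominus>\<^bsub>N\<^esub> f x"
  using f_add[of "\<ominus>\<^bsub>M\<^esub> x" x] f_zero f_closed by (simp add: N.M.minus_equality M.M.l_neg)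

lemma f_minus: "\<lbrakk>x \<in> carrier M; y \<in> carrier M\<rbrakk> \<Longrightarrow> f (x \<ominus>\<^bsub>M\<^esub> y) = f x \<ominus>\<^bsub>N\<^esub> f y"
  by (simp add: a_minus_def f_add f_uminus)

lemma submodule_vimage:
  assumes "submodule K R N"
  shows "submodule {x \<in> carrier M. f x \<in> K} R M"
  using N.submoduleD[OF assms]
  by (intro M.submoduleI) (auto simp: f_zero f_add f_ract M.ract_closed)

lemma submodule_image:
  assumes "submodule K R M"
  shows "submodule (f ` K) R N"
proof (rule N.submoduleI)
  note K = M.submoduleD[OF assms]
  show "f ` K \<subseteq> carrier N" using K(1) f_closed by auto
  show "\<zero>\<^bsub>N\<^esub> \<in> f ` K" using K(2) f_zero by (metis image_eqI)
  show "x \<oplus>\<^bsub>N\<^esub> y \<in> f ` K" if "x \<in> f ` K" "y \<in> f ` K" for x y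
    using that K(1,3) f_add by (auto simp: subset_iff) (metis image_eqI)
  show "r \<odot>\<^bsub>N\<^esub> x \<in> f ` K" if "r \<in> carrier R" "x \<in> f ` K" for r x
    using that K(1,4) f_ract by (auto simp: subset_iff) (metis image_eqI)
qed

text \<open>Two elements with the same image differ by an element of the kernel, so a submodule
  containing the kernel is a union of fibres of \<open>f\<close>.\<close>

lemma vimage_image:
  assumes "submodule K R M" "{x \<in> carrier M. f x = \<zero>\<^bsub>N\<^esub>} \<subseteq> K"
  shows "{x \<in> carrier M. f x \<in> f ` K} = K"
proof (intro equalityI subsetI)
  note K = M.submoduleD[OF assms(1)]
  fix x assume "x \<in> {x \<in> carrier M. f x \<in> f ` K}"
  then obtain y where x: "x \<in> carrier M" and y: "y \<in> K" "f x = f y" by auto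
  then have yc: "y \<in> carrier M" using K(1) by auto
  have "f (x \<ominus>\<^bsub>M\<^esub> y) = \<zero>\<^bsub>N\<^esub>"
    using f_minus[OF x yc] x yc y(2) by (simp add: f_closed a_minus_def N.M.r_neg)
  then have "x \<ominus>\<^bsub>M\<^esub> y \<in> K" using assms(2) x yc by auto
  then have "(x \<ominus>\<^bsub>M\<^esub> y) \<oplus>\<^bsub>M\<^esub> y \<in> K" using y K(3) by blast
  then show "x \<in> K" using x yc by (simp add: a_minus_def M.M.a_assoc M.M.l_neg)
next
  fix x assume "x \<in> K"
  then show "x \<in> {x \<in> carrier M. f x \<in> f ` K}" using M.submodule_subset[OF assms(1)] by auto
qed

lemma maximal_submodule_vimage:
  assumes K: "maximal_submodule K R N"
  shows "maximal_submodule {x \<in> carrier M. f x \<in> K} R M" (is "maximal_submodule ?V R M")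
proof -
  have K': "submodule K R N" "K \<noteq> carrier N" using K by (auto simp: maximal_submodule_def)
  note KD = N.submoduleD[OF K'(1)]
  have "?V \<noteq> carrier M"
  proof
    assume "?V = carrier M"
    then have "f ` carrier M \<subseteq> K" by blast
    then show False using K'(2) KD(1) f_image by auto
  qed
  moreover have "L = ?V \<or> L = carrier M" if L: "submodule L R M" "?V \<subseteq> L" for L
  proof -
    \<comment> \<open>The kernel lies in \<open>?V\<close>, because \<open>K\<close> contains zero,
      and hence in \<open>L\<close>. So \<open>L\<close> is recovered from its image, to which the
      maximality of \<open>K\<close> applies.\<close>
    have LV: "{x \<in> carrier M. f x \<in> f ` L} = L"
      using L(2) KD(2) by (intro vimage_image[OF L(1)]) auto
    have "K \<subseteq> f ` L"
    proof
      fix y assume y: "y \<in> K"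
      then have "y \<in> f ` carrier M" using KD(1) f_image by blast
      then show "y \<in> f ` L" using y L(2) by blast
    qed
    then have "f ` L = K \<or> f ` L = carrier N"
      using K submodule_image[OF L(1)] by (auto simp: maximal_submodule_def)
    then show ?thesis using LV f_closed by auto
  qed
  ultimately show ?thesis using submodule_vimage[OF K'(1)] by (auto simp: maximal_submodule_def)
qed

lemma maximal_submodule_image:
  assumes K: "maximal_submodule K R M" and ker: "{x \<in> carrier M. f x = \<zero>\<^bsub>N\<^esub>} \<subseteq> K"
  shows "maximal_submodule (f ` K) R N"
proof -
  have K': "submodule K R M" "K \<noteq> carrier M" using K by (auto simp: maximal_submodule_def)
  have KV: "{x \<in> carrier M. f x \<in> f ` K} = K" by (rule vimage_image) fact+
  have "f ` K \<noteq> carrier N" using KV K'(2) f_closed by auto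
  moreover have "L = f ` K \<or> L = carrier N" if L: "submodule L R N" "f ` K \<subseteq> L" for L
  proof -
    let ?V = "{x \<in> carrier M. f x \<in> L}"
    \<comment> \<open>Surjectivity recovers \<open>L\<close> from its preimage, and the preimage is
      then compared with the maximal \<open>K\<close>.\<close>
    have LV: "L = f ` ?V" using N.submodule_subset[OF L(1)] f_image by auto
    have "K \<subseteq> ?V" using L(2) M.submodule_subset[OF K'(1)] by auto
    then have "?V = K \<or> ?V = carrier M"
      using K submodule_vimage[OF L(1)] by (auto simp: maximal_submodule_def)
    then show ?thesis using LV f_image by auto
  qed
  ultimately show ?thesis using submodule_image[OF K'(1)] by (auto simp: maximal_submodule_def)
qed

end

section \<open>Quotient modules\<close>

context right_module
begin

lemma submodule_imp_abelian_subgroup: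
  assumes "submodule N R M"
  shows "abelian_subgroup N M"
  using assms submodule.axioms(1) M.abelian_group_axioms
  by (intro abelian_subgroupI3 additive_subgroup.intro) auto

context
  fixes N
  assumes N: "submodule N R M"
begin

interpretation N: abelian_subgroup N M
  by (rule submodule_imp_abelian_subgroup) (rule N)

lemma carrier_quotient: "carrier (quotient_module M N) = (\<lambda>x. N +>\<^bsub>M\<^esub> x) ` carrier M"
  by (auto simp: quotient_module_def A_RCOSETS_def RCOSETS_def a_r_coset_def)

lemma zero_quotient: "\<zero>\<^bsub>quotient_module M N\<^esub> = N +>\<^bsub>M\<^esub> \<zero>\<^bsub>M\<^esub>"
  using N.a_rcos_const submodule_zero[OF N] by (simp add: quotient_module_def)

lemma add_quotient:
  "\<lbrakk>x \<in> carrier M; y \<in> carrier M\<rbrakk> \<Longrightarrow>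
    (N +>\<^bsub>M\<^esub> x) \<oplus>\<^bsub>quotient_module M N\<^esub> (N +>\<^bsub>M\<^esub> y) = N +>\<^bsub>M\<^esub> (x \<oplus>\<^bsub>M\<^esub> y)"
  using N.a_rcos_sum by (simp add: quotient_module_def)

lemma mem_coset_iff:
  assumes "x \<in> carrier M"
  shows "y \<in> N +>\<^bsub>M\<^esub> x \<longleftrightarrow> y \<in> carrier M \<and> y \<ominus>\<^bsub>M\<^esub> x \<in> N"
  using assms N.a_elemrcos_carrier N.a_rcos_module by (metis a_minus_def)

lemma coset_eq_iff:
  assumes "x \<in> carrier M" "y \<in> carrier M"
  shows "N +>\<^bsub>M\<^esub> x = N +>\<^bsub>M\<^esub> y \<longleftrightarrow> x \<ominus>\<^bsub>M\<^esub> y \<in> N"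
  using assms mem_coset_iff N.a_repr_independence' N.a_rcos_self by metis

text \<open>The action on a coset is a union over all its representatives. All of them yield the
  same coset, since \<open>N\<close> is closed under the action, and the index set is nonempty, so
  the union collapses to a single term.\<close>

lemma ract_quotient:
  assumes r: "r \<in> carrier R" and x: "x \<in> carrier M"
  shows "r \<odot>\<^bsub>quotient_module M N\<^esub> (N +>\<^bsub>M\<^esub> x) = N +>\<^bsub>M\<^esub> (r \<odot>\<^bsub>M\<^esub> x)"
proof -
  have "N +>\<^bsub>M\<^esub> (r \<odot>\<^bsub>M\<^esub> y) = N +>\<^bsub>M\<^esub> (r \<odot>\<^bsub>M\<^esub> x)" if "y \<in> N +>\<^bsub>M\<^esub> x" for y
  proof -
    have y: "y \<in> carrier M" "y \<ominus>\<^bsub>M\<^esub> x \<in> N" using that x by (auto simp: mem_coset_iff)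
    have "r \<odot>\<^bsub>M\<^esub> \<ominus>\<^bsub>M\<^esub> x = \<ominus>\<^bsub>M\<^esub> (r \<odot>\<^bsub>M\<^esub> x)" by (rule ract_minus_right) fact+
    then have "r \<odot>\<^bsub>M\<^esub> y \<ominus>\<^bsub>M\<^esub> r \<odot>\<^bsub>M\<^esub> x = r \<odot>\<^bsub>M\<^esub> (y \<ominus>\<^bsub>M\<^esub> x)"
      using r x y by (simp add: a_minus_def ract_distr_module)
    then show ?thesis
      using r x y submodule_smult[OF N] by (simp add: coset_eq_iff ract_closed)
  qed
  then have "(\<Union>y\<in>N +>\<^bsub>M\<^esub> x. N +>\<^bsub>M\<^esub> (r \<odot>\<^bsub>M\<^esub> y)) = (\<Union>y\<in>N +>\<^bsub>M\<^esub> x. N +>\<^bsub>M\<^esub> (r \<odot>\<^bsub>M\<^esub> x))"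
    by (rule SUP_cong[OF refl])
  moreover have "N +>\<^bsub>M\<^esub> x \<noteq> {}" using N.a_rcos_self[OF x] by blast
  ultimately show ?thesis by (simp only: quotient_module_def module.simps UN_constant if_False)
qed

lemma right_module_quotient: "right_module R (quotient_module M N)"
proof -
  have "abelian_group (quotient_module M N)"
  proof (rule abelian_groupI, goal_cases)
    case (6 X)
    then obtain x where "x \<in> carrier M" "X = N +>\<^bsub>M\<^esub> x" by (auto simp: carrier_quotient)
    then show ?case
      by (intro bexI[of _ "N +>\<^bsub>M\<^esub> (\<ominus>\<^bsub>M\<^esub> x)"])
        (auto simp: carrier_quotient zero_quotient add_quotient M.l_neg)
  qed (auto simp: carrier_quotient zero_quotient add_quotient M.a_ac)
  then show ?thesis
    by (intro right_module.intro right_module_axioms.intro R.ring_axioms)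
      (auto simp: carrier_quotient add_quotient ract_quotient ract_closed ract_distr_ring
        ract_distr_module ract_assoc ract_one)
qed

lemma module_epi_quotient: "module_epi R M (quotient_module M N) (\<lambda>x. N +>\<^bsub>M\<^esub> x)"
  by (intro module_epi.intro module_epi_axioms.intro right_module_axioms right_module_quotient)
    (auto simp: carrier_quotient add_quotient ract_quotient)

lemma coset_eq_zero_iff:
  assumes "x \<in> carrier M"
  shows "N +>\<^bsub>M\<^esub> x = \<zero>\<^bsub>quotient_module M N\<^esub> \<longleftrightarrow> x \<in> N"
proof -
  have "x \<ominus>\<^bsub>M\<^esub> \<zero>\<^bsub>M\<^esub> = x"
    using assms M.minus_equality[of "\<zero>\<^bsub>M\<^esub>" "\<zero>\<^bsub>M\<^esub>"] by (simp add: a_minus_def)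
  then show ?thesis using coset_eq_iff[OF assms M.zero_closed] by (simp add: zero_quotient)
qed

text \<open>The preimage of \<open>K\<close> under the projection is maximal, and it contains
  \<open>N\<close> because \<open>K\<close> contains the zero coset.\<close>

lemma maximal_submodule_quotientD:
  assumes "maximal_submodule K R (quotient_module M N)"
  shows "\<exists>L. maximal_submodule L R M \<and> N \<subseteq> L"
proof -
  interpret E: module_epi R M "quotient_module M N" "\<lambda>x. N +>\<^bsub>M\<^esub> x" by (rule module_epi_quotient)
  have K: "\<zero>\<^bsub>quotient_module M N\<^esub> \<in> K"
    using assms E.N.submodule_zero by (auto simp: maximal_submodule_def)
  have "N \<subseteq> {x \<in> carrier M. N +>\<^bsub>M\<^esub> x \<in> K}"
  proof
    fix x assume "x \<in> N"
    then have "x \<in> carrier M" using submodule_subset[OF N] by auto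
    then show "x \<in> {x \<in> carrier M. N +>\<^bsub>M\<^esub> x \<in> K}"
      using K coset_eq_zero_iff[of x] \<open>x \<in> N\<close> by auto
  qed
  then show ?thesis using E.maximal_submodule_vimage[OF assms] by blast
qed

lemma maximal_submodule_quotientI:
  assumes "maximal_submodule L R M" "N \<subseteq> L"
  shows "\<exists>K. maximal_submodule K R (quotient_module M N)"
proof -
  interpret E: module_epi R M "quotient_module M N" "\<lambda>x. N +>\<^bsub>M\<^esub> x" by (rule module_epi_quotient)
  show ?thesis
    using E.maximal_submodule_image[OF assms(1)] assms(2) coset_eq_zero_iff by blast
qed

text \<open>The composite of the projection with \<open>h\<close> maps \<open>M\<close> onto the
  simple \<open>B\<close>. Its kernel is the preimage of a maximal submodule, hence maximal, and
  injectivity of \<open>h\<close> identifies this kernel with \<open>N\<close>.\<close>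

lemma maximal_submodule_if_quotient_iso_simple:
  assumes B: "simple_submodule B R M"
    and h: "h \<in> module_iso R (quotient_module M N) (M\<lparr>carrier := B\<rparr>)"
  shows "maximal_submodule N R M"
proof -
  interpret E: module_epi R M "quotient_module M N" "\<lambda>x. N +>\<^bsub>M\<^esub> x" by (rule module_epi_quotient)
  have B': "submodule B R M" using B by (simp add: simple_submodule_iff)
  interpret B: right_module R "M\<lparr>carrier := B\<rparr>" by (rule right_module_submodule) (rule B')
  interpret H: module_epi R "quotient_module M N" "M\<lparr>carrier := B\<rparr>" h
    using h by unfold_locales (auto simp: module_iso_def iso_def hom_def bij_betw_def)
  have inj: "inj_on h (carrier (quotient_module M N))"
    using h by (auto simp: module_iso_def iso_def bij_betw_def)
  have "maximal_submodule {\<zero>\<^bsub>M\<^esub>} R (M\<lparr>carrier := B\<rparr>)"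
    using B B.simple_module_iff_maximal by (simp add: simple_submodule_def)
  from E.maximal_submodule_vimage[OF H.maximal_submodule_vimage[OF this]]
  have "maximal_submodule {x \<in> carrier M. h (N +>\<^bsub>M\<^esub> x) = \<zero>\<^bsub>M\<^esub>} R M"
    using E.f_closed by (simp cong: conj_cong)
  moreover have "h (N +>\<^bsub>M\<^esub> x) = \<zero>\<^bsub>M\<^esub> \<longleftrightarrow> x \<in> N" if "x \<in> carrier M" for x
    using inj_on_eq_iff[OF inj E.f_closed[OF that] E.N.zero_closed] H.f_zero
      coset_eq_zero_iff[OF that] by simp
  ultimately have "maximal_submodule {x \<in> carrier M. x \<in> N} R M"
    by (simp cong: conj_cong)
  moreover have "{x \<in> carrier M. x \<in> N} = N" using submodule_subset[OF N] by auto
  ultimately show ?thesis by simp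
qed

end

section \<open>Cyclic submodules, transporters and the effect of locality\<close>

lemma ract_diff_left:
  assumes "r \<in> carrier R" "s \<in> carrier R" "x \<in> carrier M"
  shows "(r \<ominus>\<^bsub>R\<^esub> s) \<odot>\<^bsub>M\<^esub> x = r \<odot>\<^bsub>M\<^esub> x \<ominus>\<^bsub>M\<^esub> s \<odot>\<^bsub>M\<^esub> x"
  using assms by (simp add: a_minus_def ract_distr_ring ract_minus_left)

lemma submodule_cyclic:
  assumes "x \<in> carrier M"
  shows "submodule ((\<lambda>r. r \<odot>\<^bsub>M\<^esub> x) ` carrier R) R M" (is "submodule ?C R M")
proof (rule submoduleI)
  show "?C \<subseteq> carrier M" using assms by (auto simp: ract_closed)
  show "\<zero>\<^bsub>M\<^esub> \<in> ?C" using assms ract_zero_left by (metis R.zero_closed image_eqI)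
  show "y \<oplus>\<^bsub>M\<^esub> z \<in> ?C" if "y \<in> ?C" "z \<in> ?C" for y z
    using that assms by (auto simp: ract_distr_ring[symmetric])
  show "r \<odot>\<^bsub>M\<^esub> y \<in> ?C" if "r \<in> carrier R" "y \<in> ?C" for r y
    using that assms by (auto simp: ract_assoc[symmetric])
qed

lemma mem_cyclic: "x \<in> carrier M \<Longrightarrow> x \<in> (\<lambda>r. r \<odot>\<^bsub>M\<^esub> x) ` carrier R"
  using ract_one by (metis R.one_closed image_eqI)

text \<open>The sum of \<open>N\<close> and the cyclic submodule generated by \<open>x\<close> lies
  strictly above \<open>N\<close>, so it is all of \<open>M\<close>.\<close>

lemma maximal_submodule_cyclic_supplement:
  assumes N: "maximal_submodule N R M" and x: "x \<in> carrier M" "x \<notin> N" and y: "y \<in> carrier M"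
  obtains n r where "n \<in> N" "r \<in> carrier R" "y = n \<oplus>\<^bsub>M\<^esub> r \<odot>\<^bsub>M\<^esub> x"
proof -
  let ?C = "(\<lambda>r. r \<odot>\<^bsub>M\<^esub> x) ` carrier R"
  have N': "submodule N R M" using N by (simp add: maximal_submodule_def)
  have C: "submodule ?C R M" using x(1) by (rule submodule_cyclic)
  have "N <+>\<^bsub>M\<^esub> ?C = carrier M"
    using N submodule_set_add[OF N' C] subset_set_add[OF N' C] mem_cyclic[OF x(1)] x(2)
    unfolding maximal_submodule_def by blast
  then have "y \<in> N <+>\<^bsub>M\<^esub> ?C" using y by simp
  then show thesis using that unfolding set_add_iff by blast
qed

text \<open>Let a right ideal \<open>J\<close> above \<open>?I\<close> contain some \<open>r\<close>
  with \<open>x r\<close> outside \<open>N\<close>. Then \<open>x r\<close> generates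
  \<open>M\<close> modulo \<open>N\<close>, so \<open>x = n + x r t\<close> for some
  \<open>n\<close> in \<open>N\<close>. Thus \<open>1 - r t\<close> lies in \<open>?I\<close>, while
  \<open>r t\<close> lies in \<open>J\<close>, and their sum puts \<open>1\<close> into
  \<open>J\<close>.\<close>

lemma maximal_right_ideal_transporter:
  assumes N: "maximal_submodule N R M" and x: "x \<in> carrier M" "x \<notin> N"
  shows "maximal_right_ideal {r \<in> carrier R. r \<odot>\<^bsub>M\<^esub> x \<in> N} R" (is "maximal_right_ideal ?I R")
proof -
  have N': "submodule N R M" using N by (simp add: maximal_submodule_def)
  note ND = submoduleD[OF N']
  have "subgroup ?I (add_monoid R)"
  proof (rule R.add.subgroupI)
    have "\<zero>\<^bsub>R\<^esub> \<in> ?I" using x ND(2) by simp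
    then show "?I \<noteq> {}" by blast
  qed (use x ND in \<open>auto simp: ract_minus_left ract_distr_ring\<close>)
  then have I: "right_ideal ?I R"
    using x ND by (auto simp: right_ideal_def additive_subgroup_def ract_assoc)
  have "\<one>\<^bsub>R\<^esub> \<notin> ?I" using x by (simp add: ract_one)
  then have "?I \<noteq> carrier R" using R.one_closed by blast
  moreover have "J = carrier R" if J: "right_ideal J R" "?I \<subseteq> J" and "J \<noteq> ?I" for J
  proof -
    have Jadd: "additive_subgroup J R" using J(1) by (simp add: right_ideal_def)
    have Jsub: "J \<subseteq> carrier R" by (rule additive_subgroup.a_subset[OF Jadd])
    obtain r where r: "r \<in> J" "r \<notin> ?I" using J(2) \<open>J \<noteq> ?I\<close> by blast
    then have rc: "r \<in> carrier R" using Jsub by blast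
    then have rx: "r \<odot>\<^bsub>M\<^esub> x \<in> carrier M" "r \<odot>\<^bsub>M\<^esub> x \<notin> N" using r x by (auto simp: ract_closed)
    obtain n t where nt: "n \<in> N" "t \<in> carrier R" "x = n \<oplus>\<^bsub>M\<^esub> t \<odot>\<^bsub>M\<^esub> (r \<odot>\<^bsub>M\<^esub> x)"
      using maximal_submodule_cyclic_supplement[OF N rx x(1)] by blast
    let ?rt = "r \<otimes>\<^bsub>R\<^esub> t"
    have rt: "?rt \<in> carrier R" using rc nt(2) by simp
    have n: "n \<in> carrier M" using nt(1) ND(1) by blast
    have "(\<one>\<^bsub>R\<^esub> \<ominus>\<^bsub>R\<^esub> ?rt) \<odot>\<^bsub>M\<^esub> x = x \<ominus>\<^bsub>M\<^esub> ?rt \<odot>\<^bsub>M\<^esub> x"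
      using rt x by (simp add: ract_diff_left ract_one)
    also have "x = n \<oplus>\<^bsub>M\<^esub> ?rt \<odot>\<^bsub>M\<^esub> x" using nt(2,3) rc x by (simp add: ract_assoc)
    then have "x \<ominus>\<^bsub>M\<^esub> ?rt \<odot>\<^bsub>M\<^esub> x = n"
      using n rt x(1) ract_closed[OF rt x(1)]
      by (metis M.add.inv_solve_right a_minus_def)
    finally have "\<one>\<^bsub>R\<^esub> \<ominus>\<^bsub>R\<^esub> ?rt \<in> J" using J(2) nt(1) rt by auto
    moreover have "?rt \<in> J" using J(1) r(1) nt(2) by (simp add: right_ideal_def)
    ultimately have "(\<one>\<^bsub>R\<^esub> \<ominus>\<^bsub>R\<^esub> ?rt) \<oplus>\<^bsub>R\<^esub> ?rt \<in> J"
      by (rule additive_subgroup.a_closed[OF Jadd])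
    then have "\<one>\<^bsub>R\<^esub> \<in> J" using rt by (simp add: a_minus_def R.a_assoc R.l_neg)
    then have "\<one>\<^bsub>R\<^esub> \<otimes>\<^bsub>R\<^esub> s \<in> J" if "s \<in> carrier R" for s
      using J(1) that unfolding right_ideal_def by blast
    then show ?thesis using Jsub by auto
  qed
  ultimately show ?thesis using I by (auto simp: maximal_right_ideal_def)
qed

lemma local_ring_simple_iso:
  assumes "local_ring R" and N: "maximal_submodule N R M" and S: "simple_submodule S R M"
  shows "module_iso R (quotient_module M N) (M\<lparr>carrier := S\<rparr>) \<noteq> {}"
proof -
  let ?Q = "quotient_module M N"
  have N': "submodule N R M" "N \<noteq> carrier M" using N by (auto simp: maximal_submodule_def)
  have S': "submodule S R M" "S \<noteq> {\<zero>\<^bsub>M\<^esub>}" using S by (auto simp: simple_submodule_iff)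
  interpret S: right_module R "M\<lparr>carrier := S\<rparr>" by (rule right_module_submodule) fact
  obtain x where x: "x \<in> carrier M" "x \<notin> N" using N' submodule_subset by blast
  obtain s where s: "s \<in> S" "s \<noteq> \<zero>\<^bsub>M\<^esub>" using S' submodule_zero by blast
  have sc: "s \<in> carrier M" using s(1) submodule_subset[OF S'(1)] by blast
  have S0: "maximal_submodule {\<zero>\<^bsub>M\<^esub>} R (M\<lparr>carrier := S\<rparr>)"
    using S S.simple_module_iff_maximal by (simp add: simple_submodule_def)
  \<comment> \<open>This is where locality enters: both sides are maximal right ideals, the right
    one by the transporter lemma applied to the zero submodule of \<open>S\<close>.\<close>
  have "{r \<in> carrier R. r \<odot>\<^bsub>M\<^esub> x \<in> N} = {r \<in> carrier R. r \<odot>\<^bsub>M\<^esub> s \<in> {\<zero>\<^bsub>M\<^esub>}}"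
    using assms(1) maximal_right_ideal_transporter[OF N x]
      S.maximal_right_ideal_transporter[OF S0, of s] s
    by (auto simp: local_ring_def)
  then have ann: "r \<odot>\<^bsub>M\<^esub> x \<in> N \<longleftrightarrow> r \<odot>\<^bsub>M\<^esub> s = \<zero>\<^bsub>M\<^esub>" if "r \<in> carrier R" for r
    using that by blast
  \<comment> \<open>One direction will make \<open>h\<close> well defined, the other
    injective.\<close>
  have coset_iff: "N +>\<^bsub>M\<^esub> (r \<odot>\<^bsub>M\<^esub> x) = N +>\<^bsub>M\<^esub> (t \<odot>\<^bsub>M\<^esub> x) \<longleftrightarrow> r \<odot>\<^bsub>M\<^esub> s = t \<odot>\<^bsub>M\<^esub> s"
    if "r \<in> carrier R" "t \<in> carrier R" for r t
    using that ann[of "r \<ominus>\<^bsub>R\<^esub> t"] x(1) sc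
    by (simp add: coset_eq_iff[OF N'(1)] ract_diff_left ract_closed minus_eq_zero_iff)
  have Q: "carrier ?Q = (\<lambda>r. N +>\<^bsub>M\<^esub> (r \<odot>\<^bsub>M\<^esub> x)) ` carrier R"
  proof
    show "carrier ?Q \<subseteq> (\<lambda>r. N +>\<^bsub>M\<^esub> (r \<odot>\<^bsub>M\<^esub> x)) ` carrier R"
    proof
      fix X assume "X \<in> carrier ?Q"
      then obtain y where y: "y \<in> carrier M" "X = N +>\<^bsub>M\<^esub> y"
        by (auto simp: carrier_quotient[OF N'(1)])
      obtain n r where nr: "n \<in> N" "r \<in> carrier R" "y = n \<oplus>\<^bsub>M\<^esub> r \<odot>\<^bsub>M\<^esub> x"
        using maximal_submodule_cyclic_supplement[OF N x y(1)] by blast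
      have n: "n \<in> carrier M" using nr(1) submodule_subset[OF N'(1)] by blast
      have "y \<ominus>\<^bsub>M\<^esub> r \<odot>\<^bsub>M\<^esub> x = n"
        using n nr(2,3) y(1) ract_closed[OF nr(2) x(1)] by (metis M.add.inv_solve_right a_minus_def)
      then have "X = N +>\<^bsub>M\<^esub> (r \<odot>\<^bsub>M\<^esub> x)"
        using y nr x(1) by (simp add: coset_eq_iff[OF N'(1)] ract_closed)
      then show "X \<in> (\<lambda>r. N +>\<^bsub>M\<^esub> (r \<odot>\<^bsub>M\<^esub> x)) ` carrier R" using nr(2) by blast
    qed
  qed (use x(1) in \<open>auto simp: carrier_quotient[OF N'(1)] ract_closed\<close>)
  \<comment> \<open>The map sends the coset of \<open>x r\<close> to \<open>s r\<close>. Every coset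
    has such an \<open>r\<close> by \<open>Q\<close>, and \<open>coset_iff\<close> shows that the
    choice does not affect the value.\<close>
  define h where "h X = (SOME r. r \<in> carrier R \<and> X = N +>\<^bsub>M\<^esub> (r \<odot>\<^bsub>M\<^esub> x)) \<odot>\<^bsub>M\<^esub> s" for X
  have h: "h (N +>\<^bsub>M\<^esub> (r \<odot>\<^bsub>M\<^esub> x)) = r \<odot>\<^bsub>M\<^esub> s" if r: "r \<in> carrier R" for r
  proof -
    let ?P = "\<lambda>t. t \<in> carrier R \<and> N +>\<^bsub>M\<^esub> (r \<odot>\<^bsub>M\<^esub> x) = N +>\<^bsub>M\<^esub> (t \<odot>\<^bsub>M\<^esub> x)"
    have P: "?P (Eps ?P)" by (rule someI[of ?P r]) (simp add: r)
    show ?thesis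
      unfolding h_def using iffD1[OF coset_iff[OF r conjunct1[OF P]] conjunct2[OF P]] by (rule sym)
  qed
  \<comment> \<open>A nonzero element generates a simple module; this gives surjectivity of
    \<open>h\<close>.\<close>
  have "(\<lambda>r. r \<odot>\<^bsub>M\<^esub> s) ` carrier R = S"
  proof -
    have "(\<lambda>r. r \<odot>\<^bsub>M\<^esub> s) ` carrier R \<subseteq> S" using submodule_smult[OF S'(1)] s(1) by auto
    moreover have "(\<lambda>r. r \<odot>\<^bsub>M\<^esub> s) ` carrier R \<noteq> {\<zero>\<^bsub>M\<^esub>}" using mem_cyclic[OF sc] s(2) by auto
    ultimately show ?thesis using S submodule_cyclic[OF sc] unfolding simple_submodule_iff by blast
  qed
  then have "h ` carrier ?Q = S" using h by (simp add: Q image_image cong: image_cong)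
  moreover have "inj_on h (carrier ?Q)"
    using coset_iff by (auto simp: inj_on_def Q h)
  moreover have "h (X \<oplus>\<^bsub>?Q\<^esub> Y) = h X \<oplus>\<^bsub>M\<^esub> h Y" if XY: "X \<in> carrier ?Q" "Y \<in> carrier ?Q" for X Y
  proof -
    obtain r t where rt: "r \<in> carrier R" "t \<in> carrier R"
      "X = N +>\<^bsub>M\<^esub> (r \<odot>\<^bsub>M\<^esub> x)" "Y = N +>\<^bsub>M\<^esub> (t \<odot>\<^bsub>M\<^esub> x)"
      using XY unfolding Q by blast
    then have "X \<oplus>\<^bsub>?Q\<^esub> Y = N +>\<^bsub>M\<^esub> ((r \<oplus>\<^bsub>R\<^esub> t) \<odot>\<^bsub>M\<^esub> x)"
      using x(1) by (simp add: add_quotient[OF N'(1)] ract_closed ract_distr_ring)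
    then show ?thesis using rt sc by (simp add: h ract_distr_ring)
  qed
  moreover have "h (r \<odot>\<^bsub>?Q\<^esub> X) = r \<odot>\<^bsub>M\<^esub> h X" if rX: "r \<in> carrier R" "X \<in> carrier ?Q" for r X
  proof -
    obtain t where t: "t \<in> carrier R" "X = N +>\<^bsub>M\<^esub> (t \<odot>\<^bsub>M\<^esub> x)"
      using rX(2) unfolding Q by blast
    then have "r \<odot>\<^bsub>?Q\<^esub> X = N +>\<^bsub>M\<^esub> ((t \<otimes>\<^bsub>R\<^esub> r) \<odot>\<^bsub>M\<^esub> x)"
      using x(1) rX(1) by (simp add: ract_quotient[OF N'(1)] ract_closed ract_assoc)
    then show ?thesis using t rX(1) sc by (simp add: h ract_assoc)
  qed
  ultimately have "h \<in> module_iso R ?Q (M\<lparr>carrier := S\<rparr>)"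
    by (auto simp: module_iso_def iso_def hom_def bij_betw_def)
  then show ?thesis by blast
qed

section \<open>Finite sums and sums of families of submodules\<close>

lemma finsum_in_submodule:
  assumes K: "submodule K R M" and "finite F" "\<And>i. i \<in> F \<Longrightarrow> g i \<in> K"
  shows "(\<Oplus>\<^bsub>M\<^esub>i\<in>F. g i) \<in> K"
  using assms(2,3)
proof (induction F)
  case empty
  then show ?case using submodule_zero[OF K] by simp
next
  case (insert i F)
  then have "g \<in> F \<rightarrow> carrier M" "g i \<in> carrier M" using submodule_subset[OF K] by auto
  then show ?case using insert submodule_add[OF K] by simp
qed

lemma finsum_ract:
  assumes "finite F" "g \<in> F \<rightarrow> carrier M" "r \<in> carrier R"
  shows "r \<odot>\<^bsub>M\<^esub> (\<Oplus>\<^bsub>M\<^esub>i\<in>F. g i) = (\<Oplus>\<^bsub>M\<^esub>i\<in>F. r \<odot>\<^bsub>M\<^esub> g i)"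
  using assms
proof (induction F)
  case (insert i F)
  then have "g \<in> F \<rightarrow> carrier M" "g i \<in> carrier M" "(\<lambda>i. r \<odot>\<^bsub>M\<^esub> g i) \<in> F \<rightarrow> carrier M"
    by (auto simp: Pi_iff ract_closed)
  then show ?case using insert by (simp add: ract_distr_module ract_closed)
qed simp

context
  fixes \<S>
  assumes sub: "\<And>N. N \<in> \<S> \<Longrightarrow> submodule N R M"
begin

lemma submodule_submodule_sum: "submodule (submodule_sum M \<S>) R M"
proof (rule submoduleI)
  have mem: "f \<in> F \<rightarrow> carrier M" if "F \<subseteq> \<S>" "\<forall>N\<in>F. f N \<in> N" for f F
    using that sub submodule_subset by fastforce
  show "submodule_sum M \<S> \<subseteq> carrier M"
    using mem by (auto simp: submodule_sum_def)
  show "\<zero>\<^bsub>M\<^esub> \<in> submodule_sum M \<S>"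
  proof -
    \<comment> \<open>The empty subfamily provides zero, even when \<open>\<S>\<close> itself is
      empty.\<close>
    have "(\<Oplus>\<^bsub>M\<^esub>N\<in>({} :: 'b set set). \<zero>\<^bsub>M\<^esub>) \<in> submodule_sum M \<S>"
      unfolding submodule_sum_def by blast
    then show ?thesis by simp
  qed
  show "x \<oplus>\<^bsub>M\<^esub> y \<in> submodule_sum M \<S>"
    if xy: "x \<in> submodule_sum M \<S>" "y \<in> submodule_sum M \<S>" for x y
  proof -
    \<comment> \<open>Two elements of the sum may use different finite subfamilies. Padding with
      zeros brings both to the union, where they can be added termwise.\<close>
    have ext: "\<exists>f'. (\<Oplus>\<^bsub>M\<^esub>N\<in>F. f N) = (\<Oplus>\<^bsub>M\<^esub>N\<in>H. f' N) \<and> (\<forall>N\<in>H. f' N \<in> N)"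
      if "finite H" "F \<subseteq> H" "H \<subseteq> \<S>" "\<forall>N\<in>F. f N \<in> N" for f F H
    proof -
      let ?f = "\<lambda>N. if N \<in> F then f N else \<zero>\<^bsub>M\<^esub>"
      have in_N: "\<forall>N\<in>H. ?f N \<in> N" using that sub submodule_zero by auto
      moreover have "(\<Oplus>\<^bsub>M\<^esub>N\<in>F. f N) = (\<Oplus>\<^bsub>M\<^esub>N\<in>H. ?f N)"
        using mem[of F f] mem[OF \<open>H \<subseteq> \<S>\<close> in_N] that
        by (intro M.add.finprod_mono_neutral_cong) (auto intro: finite_subset)
      ultimately show ?thesis by blast
    qed
    obtain f F where f: "x = (\<Oplus>\<^bsub>M\<^esub>N\<in>F. f N)" "finite F" "F \<subseteq> \<S>" "\<forall>N\<in>F. f N \<in> N"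
      using xy(1) unfolding submodule_sum_def by blast
    obtain g G where g: "y = (\<Oplus>\<^bsub>M\<^esub>N\<in>G. g N)" "finite G" "G \<subseteq> \<S>" "\<forall>N\<in>G. g N \<in> N"
      using xy(2) unfolding submodule_sum_def by blast
    have FG: "finite (F \<union> G)" "F \<union> G \<subseteq> \<S>" using f g by auto
    obtain f' where f': "x = (\<Oplus>\<^bsub>M\<^esub>N\<in>F \<union> G. f' N)" "\<forall>N\<in>F \<union> G. f' N \<in> N"
      using ext[of "F \<union> G" F f] FG f by auto
    obtain g' where g': "y = (\<Oplus>\<^bsub>M\<^esub>N\<in>F \<union> G. g' N)" "\<forall>N\<in>F \<union> G. g' N \<in> N"
      using ext[of "F \<union> G" G g] FG g by auto
    have "x \<oplus>\<^bsub>M\<^esub> y = (\<Oplus>\<^bsub>M\<^esub>N\<in>F \<union> G. f' N \<oplus>\<^bsub>M\<^esub> g' N)"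
      unfolding f'(1) g'(1)
      by (rule M.finsum_addf[symmetric]) (use mem[OF FG(2)] f'(2) g'(2) in auto)
    moreover have "\<forall>N\<in>F \<union> G. f' N \<oplus>\<^bsub>M\<^esub> g' N \<in> N"
      using f'(2) g'(2) FG(2) by (auto intro!: submodule_add sub)
    ultimately show ?thesis using FG unfolding submodule_sum_def by blast
  qed
  show "r \<odot>\<^bsub>M\<^esub> x \<in> submodule_sum M \<S>" if r: "r \<in> carrier R" and x: "x \<in> submodule_sum M \<S>" for r x
  proof -
    obtain f F where f: "x = (\<Oplus>\<^bsub>M\<^esub>N\<in>F. f N)" "finite F" "F \<subseteq> \<S>" "\<forall>N\<in>F. f N \<in> N"
      using x unfolding submodule_sum_def by blast
    then have "r \<odot>\<^bsub>M\<^esub> x = (\<Oplus>\<^bsub>M\<^esub>N\<in>F. r \<odot>\<^bsub>M\<^esub> f N)"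
      using r mem by (simp add: finsum_ract)
    moreover have "\<forall>N\<in>F. r \<odot>\<^bsub>M\<^esub> f N \<in> N"
      using f r by (auto intro!: submodule_smult sub)
    ultimately show ?thesis using f(2,3) unfolding submodule_sum_def by blast
  qed
qed

text \<open>This is the universal property of the sum as a least upper bound. One direction views an
  element of a member as a sum with a single term; the other uses closure of \<open>K\<close> under
  finite sums.\<close>

lemma submodule_sum_subset_iff:
  assumes K: "submodule K R M"
  shows "submodule_sum M \<S> \<subseteq> K \<longleftrightarrow> (\<forall>N\<in>\<S>. N \<subseteq> K)"
proof (intro iffI ballI subsetI)
  fix N x assume *: "submodule_sum M \<S> \<subseteq> K" "N \<in> \<S>" "x \<in> N"
  then have "x \<in> carrier M" using sub submodule_subset by blast
  then have "(\<Oplus>\<^bsub>M\<^esub>L\<in>{N}. x) = x" by simp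
  then have "x \<in> submodule_sum M \<S>"
    using * unfolding submodule_sum_def
    by (auto intro!: exI[of _ "\<lambda>_. x"] exI[of _ "{N}"])
  then show "x \<in> K" using * by blast
next
  fix x assume *: "\<forall>N\<in>\<S>. N \<subseteq> K" "x \<in> submodule_sum M \<S>"
  then obtain f F where f: "x = (\<Oplus>\<^bsub>M\<^esub>N\<in>F. f N)" "finite F" "F \<subseteq> \<S>" "\<forall>N\<in>F. f N \<in> N"
    unfolding submodule_sum_def by blast
  show "x \<in> K" unfolding f(1) using f * by (intro finsum_in_submodule[OF K]) auto
qed

end

section \<open>Socle, radical and direct summands\<close>

lemma submodule_soc: "submodule (soc R M) R M"
  unfolding soc_def by (rule submodule_submodule_sum) (simp add: simple_submodule_def)

lemma soc_subset_iff:
  assumes "submodule K R M"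
  shows "soc R M \<subseteq> K \<longleftrightarrow> (\<forall>S. simple_submodule S R M \<longrightarrow> S \<subseteq> K)"
  unfolding soc_def
  by (subst submodule_sum_subset_iff) (auto simp: simple_submodule_def assms)

text \<open>Inclusion in an intersection and the universal property of the socle together reduce
  condition (i) to pairs, so that a single simple \<open>S\<close> not contained in a single maximal
  \<open>K\<close> refutes it.\<close>

lemma soc_subset_rad_iff:
  "soc R M \<subseteq> rad R M \<longleftrightarrow>
    (\<forall>S K. simple_submodule S R M \<and> maximal_submodule K R M \<longrightarrow> S \<subseteq> K)"
proof -
  have "soc R M \<subseteq> rad R M \<longleftrightarrow> (\<forall>K. maximal_submodule K R M \<longrightarrow> soc R M \<subseteq> K)"
    using submodule_subset[OF submodule_soc] by (auto simp: rad_def)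
  moreover have "soc R M \<subseteq> K \<longleftrightarrow> (\<forall>S. simple_submodule S R M \<longrightarrow> S \<subseteq> K)"
    if "maximal_submodule K R M" for K
    using that soc_subset_iff by (simp add: maximal_submodule_def)
  ultimately show ?thesis by (simp cong: imp_cong) blast
qed

lemma maximal_submodule_quotient_soc_iff:
  "(\<exists>K. maximal_submodule K R (quotient_module M (soc R M))) \<longleftrightarrow>
    (\<exists>N. maximal_submodule N R M \<and> soc R M \<subseteq> N)"
  using maximal_submodule_quotientD[OF submodule_soc] maximal_submodule_quotientI[OF submodule_soc]
  by blast

lemma direct_summand_complement:
  assumes "maximal_submodule N R M" "simple_submodule S R M" "\<not> S \<subseteq> N"
  shows "direct_summand N R M" "direct_summand S R M"
proof -
  note c = maximal_simple_complement[OF assms]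
  have NS: "submodule N R M" "submodule S R M"
    using assms by (auto simp: maximal_submodule_def simple_submodule_iff)
  show "direct_summand N R M" "direct_summand S R M"
    using c NS submodule_set_add_comm[OF NS] by (auto simp: direct_summand_def Int_commute)
qed

text \<open>Any complement of \<open>S\<close> is maximal, and it cannot contain \<open>S\<close>,
  since the two meet in zero and \<open>S\<close> is nonzero.\<close>

lemma simple_direct_summand_not_subset:
  assumes "simple_submodule S R M" "direct_summand S R M"
  shows "\<exists>K. maximal_submodule K R M \<and> \<not> S \<subseteq> K"
proof -
  obtain K where K: "submodule K R M" "S \<inter> K = {\<zero>\<^bsub>M\<^esub>}" "S <+>\<^bsub>M\<^esub> K = carrier M"
    using assms(2) by (auto simp: direct_summand_def)
  then have "maximal_submodule K R M" using maximal_submodule_complement assms(1) by blast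
  then show ?thesis using K(2) assms(1) by (auto simp: simple_submodule_iff)
qed

text \<open>Any complement of \<open>N\<close> is simple, hence nonzero, and meets \<open>N\<close>
  only in zero. So a maximal summand never contains the socle.\<close>

lemma maximal_direct_summand_not_superset:
  assumes "maximal_submodule N R M" "direct_summand N R M"
  shows "\<exists>S. simple_submodule S R M \<and> \<not> S \<subseteq> N"
proof -
  obtain K where K: "submodule K R M" "N \<inter> K = {\<zero>\<^bsub>M\<^esub>}" "N <+>\<^bsub>M\<^esub> K = carrier M"
    using assms(2) by (auto simp: direct_summand_def)
  then have "simple_submodule K R M" using simple_submodule_complement assms(1) by blast
  then show ?thesis using K(2) by (auto simp: simple_submodule_iff)
qed

end

theorem proposition2:
  fixes R :: "('a, 'm) ring_scheme" and M :: "('a, 'b, 'n) module_scheme"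
  assumes "local_ring R" and "right_module R M"
  shows "simple_direct_projective R M \<longleftrightarrow>
    soc R M \<subseteq> rad R M \<or>
    \<not> (\<exists>N. maximal_submodule N R (quotient_module M (soc R M)))"
proof -
  interpret right_module R M by fact
  show ?thesis
    unfolding soc_subset_rad_iff maximal_submodule_quotient_soc_iff
  proof (intro iffI)
    assume sdp: "simple_direct_projective R M"
    show "(\<forall>S K. simple_submodule S R M \<and> maximal_submodule K R M \<longrightarrow> S \<subseteq> K) \<or>
      \<not> (\<exists>N. maximal_submodule N R M \<and> soc R M \<subseteq> N)"
    \<comment> \<open>Suppose (ii) fails, witnessed by a maximal \<open>N\<close> above the socle.
      If (i) failed as well, some simple \<open>S\<close> would be a summand isomorphic to
      \<open>M/N\<close>, which would make \<open>N\<close> a summand.\<close>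
    proof (rule disjCI, intro allI impI subsetI, elim conjE)
      fix S K x
      assume *: "\<not> \<not> (\<exists>N. maximal_submodule N R M \<and> soc R M \<subseteq> N)"
        and S: "simple_submodule S R M" and K: "maximal_submodule K R M" and x: "x \<in> S"
      show "x \<in> K"
      proof (rule ccontr)
        assume "x \<notin> K"
        then have "direct_summand S R M" using direct_summand_complement[OF K S] x by blast
        moreover obtain N where N: "maximal_submodule N R M" "soc R M \<subseteq> N" using * by blast
        moreover have N': "submodule N R M" using N by (simp add: maximal_submodule_def)
        ultimately have "direct_summand N R M"
          using sdp S local_ring_simple_iso[OF assms(1) N(1) S]
          unfolding simple_direct_projective_def by blast
        then show False
          using maximal_direct_summand_not_superset[OF N(1)] N(2) soc_subset_iff[OF N'] by blast
      qed
    qed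
  next
    assume *: "(\<forall>S K. simple_submodule S R M \<and> maximal_submodule K R M \<longrightarrow> S \<subseteq> K) \<or>
      \<not> (\<exists>N. maximal_submodule N R M \<and> soc R M \<subseteq> N)"
    show "simple_direct_projective R M"
      unfolding simple_direct_projective_def
    proof (intro allI impI, elim conjE)
      fix A B
      assume A: "submodule A R M" and B: "simple_submodule B R M" "direct_summand B R M"
        and "module_iso R (quotient_module M A) (M\<lparr>carrier := B\<rparr>) \<noteq> {}"
      then have maxA: "maximal_submodule A R M"
        using maximal_submodule_if_quotient_iso_simple by blast
      \<comment> \<open>As a summand, \<open>B\<close> avoids some maximal submodule, which rules
        out the first alternative. By the second, no maximal submodule contains the socle, and in
        particular \<open>A\<close> does not.\<close>
      then have "\<not> soc R M \<subseteq> A" using * simple_direct_summand_not_subset[OF B] B(1) by blast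
      then obtain S where "simple_submodule S R M" "\<not> S \<subseteq> A" using soc_subset_iff[OF A] by blast
      then show "direct_summand A R M" using direct_summand_complement(1)[OF maxA] by blast
    qed
  qed
qed

end
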